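(* Let $G$ be a plane elementary bipartite graph (with a fixed proper black–white vertex coloring). Then the finite distributive lattice $\mathbf{M}(G)$ is irreducible, i.e. it is not isomorphic to a direct (cartesian) product of two or more finite distributive lattices each having more than one element.
   Context: A 1-factor of a graph is a perfect matching; $\mathcal{M}(G)$ denotes the set of 1-factors of $G$. A plane bipartite graph $G$ is elementary if it is connected and every edge lies in some 1-factor. Fix a proper 2-coloring (white/black) of $G$. For $M\in\mathcal{M}(G)$, a cycle $C$ is $M$-alternating if its edges are alternately in and not in $M$; it is proper (resp. improper) $M$-alternating if every edge of $C$ in $M$ goes from its white (resp. black) end-vertex to its black (resp. white) end-vertex when $C$ is traversed clockwise. The $Z$-transformation digraph $\vec Z(G)$ has vertex set $\mathcal{M}(G)$ and an arc from $M_1$ to $M_2$ whenever $M_1\oplus M_2$ is the boundary of an inner face of $G$ which is a proper $M_1$-alternating (and improper $M_2$-alternating) cycle. $\mathbf{M}(G)$ is the poset on $\mathcal{M}(G)$ with $M_1\preceq M_2$ iff $\vec Z(G)$ has a directed path from $M_2$ to $M_1$. For elementary $G$ it is known that $\mathbf{M}(G)$ is a finite distributive lattice whose Hasse diagram is $\vec Z(G)$. *)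

theory Defs
  imports "HOL-Complex_Analysis.Complex_Analysis" "HOL-Algebra.Lattice"
begin

section \<open>Plane graphs\<close>

text \<open>
  A plane graph is given by its finite set \<open>V\<close> of vertices (points of the plane) and its finite
  set \<open>E\<close> of edges, each edge being the point set of an arc that meets \<open>V\<close> exactly in its
  two distinct end points; distinct edges meet only in vertices. The end-vertices of an edge \<open>e\<close>
  are therefore the elements of \<open>e \<inter> V\<close>. Loops are excluded, parallel edges are not.
\<close>

definition plane_graph :: "complex set \<Rightarrow> complex set set \<Rightarrow> bool" where
  "plane_graph V E \<longleftrightarrow>
     finite V \<and> finite E \<and>
     (\<forall>e\<in>E. \<exists>g. arc g \<and> path_image g = e \<and> e \<inter> V = {pathstart g, pathfinish g}) \<and>
     (\<forall>e\<in>E. \<forall>e'\<in>E. e \<noteq> e' \<longrightarrow> e \<inter> e' \<subseteq> V)"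

definition proper_two_coloring ::
    "complex set \<Rightarrow> complex set set \<Rightarrow> complex set \<Rightarrow> complex set \<Rightarrow> bool" where
  "proper_two_coloring V E W B \<longleftrightarrow>
     W \<union> B = V \<and> W \<inter> B = {} \<and> (\<forall>e\<in>E. \<exists>w\<in>W. \<exists>b\<in>B. e \<inter> V = {w, b})"

definition connected_graph :: "complex set \<Rightarrow> complex set set \<Rightarrow> bool" where
  "connected_graph V E \<longleftrightarrow>
     V \<noteq> {} \<and> (\<forall>u\<in>V. \<forall>v\<in>V. (u, v) \<in> {(x, y). \<exists>e\<in>E. e \<inter> V = {x, y}}\<^sup>*)"

definition one_factors :: "complex set \<Rightarrow> complex set set \<Rightarrow> complex set set set" where
  "one_factors V E = {M. M \<subseteq> E \<and> (\<forall>v\<in>V. \<exists>!e. e \<in> M \<and> v \<in> e)}"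

definition elementary :: "complex set \<Rightarrow> complex set set \<Rightarrow> bool" where
  "elementary V E \<longleftrightarrow> connected_graph V E \<and> (\<forall>e\<in>E. \<exists>M\<in>one_factors V E. e \<in> M)"

definition inner_faces :: "complex set \<Rightarrow> complex set set \<Rightarrow> complex set set" where
  "inner_faces V E = {F \<in> components (- (V \<union> \<Union>E)). bounded F}"


section \<open>Alternating cycles\<close>

text \<open>The edge \<open>es ! i\<close> joins \<open>vs ! i\<close> to the cyclically next vertex.\<close>

definition cycle_seq ::
    "complex set \<Rightarrow> complex set set \<Rightarrow> complex list \<Rightarrow> complex set list \<Rightarrow> bool" where
  "cycle_seq V E vs es \<longleftrightarrow>
     length vs = length es \<and> 2 \<le> length es \<and> distinct vs \<and> distinct es \<and> set es \<subseteq> E \<and>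
     (\<forall>i<length es. es ! i \<inter> V = {vs ! i, vs ! (Suc i mod length es)})"

definition alternating_cycle ::
    "complex set \<Rightarrow> complex set set \<Rightarrow> complex set set \<Rightarrow> complex set set \<Rightarrow> bool" where
  "alternating_cycle V E M C \<longleftrightarrow>
     (\<exists>vs es. cycle_seq V E vs es \<and> set es = C \<and>
        (\<forall>i<length es. es ! i \<in> M \<longleftrightarrow> es ! (Suc i mod length es) \<notin> M))"

definition clockwise_loop :: "(real \<Rightarrow> complex) \<Rightarrow> bool" where
  "clockwise_loop p \<longleftrightarrow>
     simple_path p \<and> pathfinish p = pathstart p \<and>
     (\<forall>z\<in>inside (path_image p). winding_number p z = - 1)"

text \<open>
  The edge \<open>e\<close> goes from \<open>x\<close> to \<open>y\<close> when the cycle with edge set \<open>C\<close> is traversed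
  clockwise. The starting point of the traversal \<open>p\<close> is arbitrary; it only has to be chosen
  outside the interior of \<open>e\<close>, so that \<open>e\<close> is run through on one parameter interval.
\<close>

definition goes_clockwise ::
    "complex set set \<Rightarrow> complex set \<Rightarrow> complex \<Rightarrow> complex \<Rightarrow> bool" where
  "goes_clockwise C e x y \<longleftrightarrow>
     (\<exists>p s t. clockwise_loop p \<and> path_image p = \<Union>C \<and>
        0 \<le> s \<and> s < t \<and> t \<le> 1 \<and> p s = x \<and> p t = y \<and> p ` {s..t} = e)"

definition proper_alternating ::
    "complex set \<Rightarrow> complex set set \<Rightarrow> complex set \<Rightarrow> complex set \<Rightarrow>
     complex set set \<Rightarrow> complex set set \<Rightarrow> bool" where
  "proper_alternating V E W B M C \<longleftrightarrow>
     alternating_cycle V E M C \<and>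
     (\<forall>e\<in>C \<inter> M. \<exists>w\<in>W. \<exists>b\<in>B. goes_clockwise C e w b)"

definition improper_alternating ::
    "complex set \<Rightarrow> complex set set \<Rightarrow> complex set \<Rightarrow> complex set \<Rightarrow>
     complex set set \<Rightarrow> complex set set \<Rightarrow> bool" where
  "improper_alternating V E W B M C \<longleftrightarrow>
     alternating_cycle V E M C \<and>
     (\<forall>e\<in>C \<inter> M. \<exists>w\<in>W. \<exists>b\<in>B. goes_clockwise C e b w)"


section \<open>The Z-transformation digraph and the poset of 1-factors\<close>

definition Z_digraph ::
    "complex set \<Rightarrow> complex set set \<Rightarrow> complex set \<Rightarrow> complex set \<Rightarrow>
     (complex set set \<times> complex set set) set" where
  "Z_digraph V E W B =
     {(M1, M2). M1 \<in> one_factors V E \<and> M2 \<in> one_factors V E \<and>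
        (\<exists>F\<in>inner_faces V E. frontier F = \<Union>(sym_diff M1 M2)) \<and>
        proper_alternating V E W B M1 (sym_diff M1 M2) \<and>
        improper_alternating V E W B M2 (sym_diff M1 M2)}"

definition matching_order ::
    "complex set \<Rightarrow> complex set set \<Rightarrow> complex set \<Rightarrow> complex set \<Rightarrow>
     complex set set gorder" where
  "matching_order V E W B =
     \<lparr>carrier = one_factors V E, eq = (=),
      le = (\<lambda>M1 M2. (M2, M1) \<in> (Z_digraph V E W B)\<^sup>*)\<rparr>"


section \<open>Direct products of finite distributive lattices\<close>

definition finite_distributive_lattice :: "'a gorder \<Rightarrow> bool" where
  "finite_distributive_lattice L \<longleftrightarrow>
     lattice L \<and> finite (carrier L) \<and>
     (\<forall>x\<in>carrier L. \<forall>y\<in>carrier L. \<forall>z\<in>carrier L.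
        x \<sqinter>\<^bsub>L\<^esub> (y \<squnion>\<^bsub>L\<^esub> z) = (x \<sqinter>\<^bsub>L\<^esub> y) \<squnion>\<^bsub>L\<^esub> (x \<sqinter>\<^bsub>L\<^esub> z))"

definition product_order :: "'i set \<Rightarrow> ('i \<Rightarrow> 'a gorder) \<Rightarrow> ('i \<Rightarrow> 'a) gorder" where
  "product_order I L =
     \<lparr>carrier = (\<Pi>\<^sub>E i\<in>I. carrier (L i)), eq = (=),
      le = (\<lambda>x y. \<forall>i\<in>I. x i \<sqsubseteq>\<^bsub>L i\<^esub> y i)\<rparr>"

definition order_isomorphic :: "'a gorder \<Rightarrow> 'b gorder \<Rightarrow> bool" where
  "order_isomorphic P Q \<longleftrightarrow>
     (\<exists>h. bij_betw h (carrier P) (carrier Q) \<and>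
        (\<forall>x\<in>carrier P. \<forall>y\<in>carrier P. x \<sqsubseteq>\<^bsub>P\<^esub> y \<longleftrightarrow> h x \<sqsubseteq>\<^bsub>Q\<^esub> h y))"

end

theory Submission
  imports Defs
begin

text \<open>
  Orient every edge from white to black and let \<open>height M F\<close> be the total winding number of the
  edges of \<open>M\<close> around a point of the inner face \<open>F\<close>. Flipping a face \<open>F\<close> along an arc of the
  Z-transformation digraph raises the height at \<open>F\<close> by one and fixes all others, so the arcs are
  covering relations and, if the order is a direct product, opposite arcs of a square flip the same
  face. Hence the face flipped by an arc in direction \<open>i\<close> only depends on its \<open>i\<close>-th component, and
  faces of different directions are flipped independently of each other at a common 1-factor. Their
  boundaries then share no edge, and no vertex either, because the matching edge at a common vertex
  would lie on both. An edge that is never flipped lies in every 1-factor, so it meets no other edge.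
  The directions would thus split the connected graph into vertex-disjoint parts.
\<close>

section \<open>Potentials on digraphs with a product order\<close>

text \<open>The order question without geometry: \<open>S\<close> stands for the 1-factors,
  \<open>lab\<close> for the flipped face, \<open>x\<close> for the height, \<open>k\<close> for a
  parametrisation by tuples. Arcs lead downwards in the order, while the potential rises along
  them.\<close>

locale flip_product =
  fixes Z :: "('m \<times> 'm) set" and S :: "'m set"
    and lab :: "'m \<Rightarrow> 'm \<Rightarrow> 'f" and x :: "'m \<Rightarrow> 'f \<Rightarrow> real"
    and I :: "'i set" and A :: "'i \<Rightarrow> 'a set" and r :: "'i \<Rightarrow> 'a \<Rightarrow> 'a \<Rightarrow> bool"
    and k :: "('i \<Rightarrow> 'a) \<Rightarrow> 'm"
  assumes Z_sub: "Z \<subseteq> S \<times> S"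
    and pot: "(m, n) \<in> Z \<Longrightarrow> x n f = x m f + (if f = lab m n then 1 else 0)"
    and det: "(m, n) \<in> Z \<Longrightarrow> (m, n') \<in> Z \<Longrightarrow> lab m n = lab m n' \<Longrightarrow> n = n'"
    and bij: "bij_betw k (Pi\<^sub>E I A) S"
    and iso: "u \<in> Pi\<^sub>E I A \<Longrightarrow> v \<in> Pi\<^sub>E I A \<Longrightarrow>
               (k v, k u) \<in> Z\<^sup>* \<longleftrightarrow> (\<forall>i\<in>I. r i (u i) (v i))"
    and r_refl: "i \<in> I \<Longrightarrow> a \<in> A i \<Longrightarrow> r i a a"
    and r_antisym: "i \<in> I \<Longrightarrow> a \<in> A i \<Longrightarrow> b \<in> A i \<Longrightarrow> r i a b \<Longrightarrow> r i b a \<Longrightarrow> a = b"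
    and r_trans: "i \<in> I \<Longrightarrow> a \<in> A i \<Longrightarrow> b \<in> A i \<Longrightarrow> c \<in> A i \<Longrightarrow>
                   r i a b \<Longrightarrow> r i b c \<Longrightarrow> r i a c"
    and r_directed: "i \<in> I \<Longrightarrow> a \<in> A i \<Longrightarrow> b \<in> A i \<Longrightarrow> \<exists>c\<in>A i. r i a c \<and> r i b c"
begin

abbreviation P :: "('i \<Rightarrow> 'a) set" where "P \<equiv> Pi\<^sub>E I A"

definition below :: "('i \<Rightarrow> 'a) \<Rightarrow> ('i \<Rightarrow> 'a) \<Rightarrow> bool" (infix "\<preceq>" 50) where
  "u \<preceq> v \<longleftrightarrow> (\<forall>i\<in>I. r i (u i) (v i))"

lemma below_iff: "u \<in> P \<Longrightarrow> v \<in> P \<Longrightarrow> u \<preceq> v \<longleftrightarrow> (k v, k u) \<in> Z\<^sup>*"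
  by (simp add: below_def iso)

lemma upd_in_P: "v \<in> P \<Longrightarrow> i \<in> I \<Longrightarrow> a \<in> A i \<Longrightarrow> v(i := a) \<in> P"
  by (auto simp: PiE_iff extensional_def)

lemma P_component: "v \<in> P \<Longrightarrow> i \<in> I \<Longrightarrow> v i \<in> A i"
  by (auto simp: PiE_iff)

lemma k_eq_iff: "u \<in> P \<Longrightarrow> v \<in> P \<Longrightarrow> k u = k v \<longleftrightarrow> u = v"
  using bij by (auto simp: bij_betw_def inj_on_eq_iff)

lemma k_surj: assumes "m \<in> S" obtains u where "u \<in> P" "m = k u"
  using bij assms by (auto simp: bij_betw_def)

section \<open>Monotone potentials and covering relations\<close>

lemma no_loop: "(a, a) \<notin> Z"
  using pot[of a a "lab a a"] by auto

lemma potential_mono: "(a, b) \<in> Z\<^sup>* \<Longrightarrow> x a f \<le> x b f"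
proof (induction rule: rtrancl_induct)
  case (step y z)
  then show ?case using pot[of y z f] by (auto split: if_splits)
qed simp

text \<open>An arc raises the potential only at its label, by one, and no path lowers it anywhere.
  If \<open>c\<close> were strictly between, the first arcs of both partial paths would carry the
  label \<open>lab a b\<close>, and the potential would rise there by at least two.\<close>

lemma no_shortcut:
  assumes ab: "(a, b) \<in> Z" and ac: "(a, c) \<in> Z\<^sup>*" and cb: "(c, b) \<in> Z\<^sup>*"
  shows "c = a \<or> c = b"
proof (rule ccontr)
  assume n: "\<not> (c = a \<or> c = b)"
  obtain d where d: "(a, d) \<in> Z" "(d, c) \<in> Z\<^sup>*"
    using ac n by (metis converse_rtranclE)
  obtain d' where d': "(c, d') \<in> Z" "(d', b) \<in> Z\<^sup>*"
    using cb n by (metis converse_rtranclE)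
  have 1: "lab a d = lab a b"
    using pot[OF ab, of "lab a d"] pot[OF d(1), of "lab a d"]
      potential_mono[OF d(2), of "lab a d"] potential_mono[OF cb, of "lab a d"]
    by (auto split: if_splits)
  have 2: "lab c d' = lab a b"
    using pot[OF ab, of "lab c d'"] pot[OF d'(1), of "lab c d'"]
      potential_mono[OF d'(2), of "lab c d'"] potential_mono[OF ac, of "lab c d'"]
    by (auto split: if_splits)
  show False
    using 1 2 pot[OF ab, of "lab a b"] pot[OF d(1), of "lab a b"] pot[OF d'(1), of "lab a b"]
      potential_mono[OF d(2), of "lab a b"] potential_mono[OF d'(2), of "lab a b"]
    by auto
qed

lemma arc_between:
  assumes "(k v, k u) \<in> Z" "u \<in> P" "v \<in> P" "w \<in> P" "u \<preceq> w" "w \<preceq> v"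
  shows "w = u \<or> w = v"
  using no_shortcut[of "k v" "k u" "k w"] assms by (auto simp: below_iff k_eq_iff)

lemma first_arc:
  assumes "u \<in> P" "v \<in> P" "u \<preceq> v" "u \<noteq> v"
  obtains w where "w \<in> P" "(k v, k w) \<in> Z" "u \<preceq> w" "w \<preceq> v"
proof -
  have "(k v, k u) \<in> Z\<^sup>*" "k v \<noteq> k u"
    using assms by (auto simp: below_iff k_eq_iff)
  then obtain m where m: "(k v, m) \<in> Z" "(m, k u) \<in> Z\<^sup>*"
    by (metis converse_rtranclE)
  moreover obtain w where "w \<in> P" "m = k w"
    using m Z_sub k_surj by blast
  ultimately show ?thesis
    using that[of w] assms by (auto simp: below_iff)
qed

text \<open>The first arc of a path from \<open>v\<close> down to \<open>u\<close> ends between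
  them, hence at \<open>u\<close>.\<close>

lemma cover_arc:
  assumes "u \<in> P" "v \<in> P" "u \<preceq> v" "u \<noteq> v"
    and "\<And>w. w \<in> P \<Longrightarrow> u \<preceq> w \<Longrightarrow> w \<preceq> v \<Longrightarrow> w = u \<or> w = v"
  shows "(k v, k u) \<in> Z"
proof -
  obtain w where w: "w \<in> P" "(k v, k w) \<in> Z" "u \<preceq> w" "w \<preceq> v"
    using first_arc[OF assms(1-4)] .
  then show ?thesis
    using assms(5) no_loop by auto
qed

lemma arc_below: "(k v, k u) \<in> Z \<Longrightarrow> u \<in> P \<Longrightarrow> v \<in> P \<Longrightarrow> u \<preceq> v"
  by (simp add: below_iff)

text \<open>Changing only a component in which \<open>u\<close> and \<open>v\<close> differ gives an
  element between them other than \<open>v\<close>; since arcs are covers, it is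
  \<open>u\<close>.\<close>

lemma arc_direction:
  assumes "(k v, k u) \<in> Z" "u \<in> P" "v \<in> P"
  obtains i where "i \<in> I" "u = v(i := u i)"
proof -
  have le: "u \<preceq> v"
    using assms by (rule arc_below)
  have "u \<noteq> v"
    using assms no_loop by auto
  then obtain i where i: "i \<in> I" "u i \<noteq> v i"
    using assms by (meson PiE_ext)
  let ?w = "v(i := u i)"
  have w: "?w \<in> P"
    using assms i by (intro upd_in_P P_component)
  have "u \<preceq> ?w" "?w \<preceq> v"
    using le i assms by (auto simp: below_def intro: r_refl P_component)
  then have "?w = u"
    using arc_between[OF assms w] i by (metis fun_upd_same)
  then show ?thesis
    using that i by metis
qed

lemma between_upd:
  assumes w: "w \<in> P" "v(i := a) \<preceq> w" "w \<preceq> v" and v: "v \<in> P" and i: "i \<in> I"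
  shows "w = v(i := w i)"
proof (rule PiE_ext[OF w(1)])
  show "v(i := w i) \<in> P"
    using w v i by (simp only: upd_in_P P_component)
  show "w j = (v(i := w i)) j" if "j \<in> I" for j
  proof (cases "j = i")
    case False
    then have "r j (v j) (w j)" "r j (w j) (v j)"
      using w that by (auto simp: below_def)
    then have "w j = v j"
      using r_antisym that w v P_component by blast
    with False show ?thesis by simp
  qed simp
qed

text \<open>Whether lowering component \<open>i\<close> is a cover depends only on the two values in
  that component, because anything in between differs from \<open>v'\<close> at \<open>i\<close>
  alone.\<close>

lemma shift_arc:
  assumes arc: "(k v, k (v(i := a))) \<in> Z" and i: "i \<in> I" "a \<in> A i"
    and v: "v \<in> P" and v': "v' \<in> P" "v' i = v i"
  shows "(k v', k (v'(i := a))) \<in> Z"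
proof (rule cover_arc)
  have le: "v(i := a) \<preceq> v"
    using arc upd_in_P[OF v i] v by (rule arc_below)
  then have ra: "r i a (v i)"
    using i by (auto simp: below_def)
  have "a \<noteq> v i"
    using arc no_loop by auto
  then show "v'(i := a) \<noteq> v'"
    using v' by (metis fun_upd_same)
  show "v'(i := a) \<preceq> v'"
    using ra v' i by (auto simp: below_def intro: r_refl P_component)
  show "w = v'(i := a) \<or> w = v'" if w: "w \<in> P" "v'(i := a) \<preceq> w" "w \<preceq> v'" for w
  proof -
    have eq: "w = v'(i := w i)"
      using between_upd w v' i by blast
    \<comment> \<open>The intermediate value is transplanted to \<open>v\<close>, where the given
      arc forces it to be one of the two end values.\<close>
    let ?y = "v(i := w i)"
    have y: "?y \<in> P"
      using w v i by (intro upd_in_P P_component)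
    have "v(i := a) \<preceq> ?y" "?y \<preceq> v"
      using w v v' i by (auto simp: below_def intro: r_refl P_component split: if_splits)
    then have "?y = v(i := a) \<or> ?y = v"
      using arc_between[OF arc upd_in_P[OF v i] v y] by simp
    then have "w i = a \<or> w i = v i"
      by (metis fun_upd_same)
    then show ?thesis
      using eq v' by (metis fun_upd_triv)
  qed
qed (use assms upd_in_P in auto)

section \<open>Labels of arcs that change the same component\<close>

text \<open>Both ways round the square raise the potential by the same amount. The two arcs leaving
  \<open>k v\<close> have different labels by \<open>det\<close>, so the labels must match on
  opposite sides.\<close>

lemma square:
  assumes arc: "(k v, k (v(i := a))) \<in> Z" and i: "i \<in> I" "a \<in> A i"
    and v: "v \<in> P" and v': "v' \<in> P" "v' i = v i" and arc': "(k v, k v') \<in> Z"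
  shows "(k (v(i := a)), k (v'(i := a))) \<in> Z"
    and "lab (k v') (k (v'(i := a))) = lab (k v) (k (v(i := a)))"
    and "lab (k (v(i := a))) (k (v'(i := a))) = lab (k v) (k v')"
proof -
  obtain j where j: "j \<in> I" "v' = v(j := v' j)"
    using arc_direction[OF arc' v'(1) v] .
  have "j \<noteq> i"
    using j v' arc' no_loop by (metis fun_upd_triv)
  then have upd: "v'(i := a) = (v(i := a))(j := v' j)"
    using j by (metis fun_upd_twist)
  have ina: "v(i := a) \<in> P" and ina': "v'(i := a) \<in> P"
    using upd_in_P i v v' by auto
  have jv: "v' j \<in> A j"
    using v' j P_component by auto
  show arc2: "(k (v(i := a)), k (v'(i := a))) \<in> Z"
    using shift_arc[of v j "v' j" "v(i := a)"] arc' j upd v ina \<open>j \<noteq> i\<close> jv by auto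
  have arc3: "(k v', k (v'(i := a))) \<in> Z"
    using shift_arc assms by blast
  have "a \<noteq> v i"
    using arc no_loop by auto
  then have "v(i := a) \<noteq> v'"
    using v' by auto
  then have ne: "lab (k v) (k (v(i := a))) \<noteq> lab (k v) (k v')"
    using det[OF arc arc'] k_eq_iff ina v' by auto
  note * = pot[OF arc] pot[OF arc'] pot[OF arc2] pot[OF arc3]
  show "lab (k v') (k (v'(i := a))) = lab (k v) (k (v(i := a)))"
    using ne *[of "lab (k v) (k (v(i := a)))"] by (auto split: if_splits)
  show "lab (k (v(i := a))) (k (v'(i := a))) = lab (k v) (k v')"
    using ne *[of "lab (k v) (k v')"] by (auto split: if_splits)
qed

text \<open>A ladder of squares: the path from \<open>v\<close> down to \<open>u\<close> is followed
  arc by arc, and each square carries the label to the next rung.\<close>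

lemma label_below:
  assumes "(m, k u) \<in> Z\<^sup>*" and "m = k v" "v \<in> P" "u \<in> P" "v i = u i"
    and "i \<in> I" "a \<in> A i" "(k v, k (v(i := a))) \<in> Z"
  shows "lab (k u) (k (u(i := a))) = lab (k v) (k (v(i := a)))"
  using assms
proof (induction arbitrary: v rule: converse_rtrancl_induct)
  case base
  then show ?case by (simp add: k_eq_iff)
next
  case (step y z)
  obtain v' where v': "v' \<in> P" "z = k v'"
    using step.hyps Z_sub k_surj by blast
  \<comment> \<open>Component \<open>i\<close> of \<open>v'\<close> is squeezed between the equal
    values at \<open>u\<close> and \<open>v\<close>.\<close>
  have "u \<preceq> v'" "v' \<preceq> v"
    using step v' by (auto simp: below_iff)
  then have vi: "v' i = v i"
    using step v' by (metis P_component below_def r_antisym)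
  have arc: "(k v', k (v'(i := a))) \<in> Z"
    using shift_arc step v' vi by blast
  have "lab (k u) (k (u(i := a))) = lab (k v') (k (v'(i := a)))"
    using step.IH[OF v'(2,1) step.prems(3) _ step.prems(5,6)] step.prems(4) vi arc
    by (simp add: fun_upd_def)
  also have "\<dots> = lab (k v) (k (v(i := a)))"
    by (rule square(2)) (fact step.prems step.hyps v' vi | use step v' in simp)+
  finally show ?case .
qed

lemma upper_bound:
  assumes "u \<in> P" "v \<in> P"
  obtains w where "w \<in> P" "u \<preceq> w" "v \<preceq> w"
proof -
  have "\<forall>j\<in>I. \<exists>c\<in>A j. r j (u j) c \<and> r j (v j) c"
    using assms r_directed P_component by auto
  then obtain c where c: "\<And>j. j \<in> I \<Longrightarrow> c j \<in> A j \<and> r j (u j) (c j) \<and> r j (v j) (c j)"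
    by metis
  show ?thesis
    using that[of "restrict c I"] c by (simp add: below_def)
qed

lemma common_ancestor:
  assumes "m \<in> S" "m' \<in> S"
  obtains t where "(t, m) \<in> Z\<^sup>*" "(t, m') \<in> Z\<^sup>*"
proof -
  obtain u v where uv: "u \<in> P" "v \<in> P" "m = k u" "m' = k v"
    using k_surj assms by metis
  then obtain w where "w \<in> P" "u \<preceq> w" "v \<preceq> w"
    using upper_bound by blast
  then show ?thesis
    using that uv below_iff by blast
qed

text \<open>Both elements are compared, by \<open>label_below\<close>, with a common upper bound
  that agrees with them at \<open>i\<close>.\<close>

lemma label_independent:
  assumes v: "v \<in> P" and u: "u \<in> P" "u i = v i" and i: "i \<in> I" "a \<in> A i"
    and arc: "(k v, k (v(i := a))) \<in> Z"
  shows "lab (k u) (k (u(i := a))) = lab (k v) (k (v(i := a)))"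
proof -
  obtain w' where w': "w' \<in> P" "u \<preceq> w'" "v \<preceq> w'"
    using upper_bound u v by blast
  \<comment> \<open>Resetting component \<open>i\<close> keeps an upper bound, because
    \<open>u\<close> and \<open>v\<close> have the same value there.\<close>
  define w where "w = w'(i := v i)"
  have w: "w \<in> P" "w i = v i"
    using w' i v upd_in_P P_component by (simp_all add: w_def)
  have "u \<preceq> w" "v \<preceq> w"
    using w' u v i by (auto simp: below_def w_def intro: r_refl P_component)
  then have "(k w, k u) \<in> Z\<^sup>*" "(k w, k v) \<in> Z\<^sup>*"
    using u v w by (auto simp: below_iff)
  moreover have "(k w, k (w(i := a))) \<in> Z"
    using shift_arc[OF arc i v w] .
  ultimately show ?thesis
    using label_below[of "k w" u w i a] label_below[of "k w" v w i a] u v w i by auto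
qed

section \<open>Labels sorted by components\<close>

definition direction :: "'i \<Rightarrow> 'f \<Rightarrow> bool" where
  "direction i f \<longleftrightarrow>
     (\<exists>v a. v \<in> P \<and> a \<in> A i \<and> (k v, k (v(i := a))) \<in> Z \<and> lab (k v) (k (v(i := a))) = f)"

lemma arc_has_direction:
  assumes "(m, m') \<in> Z"
  obtains i where "i \<in> I" "direction i (lab m m')"
proof -
  obtain v u where vu: "v \<in> P" "u \<in> P" "m = k v" "m' = k u"
    using assms Z_sub k_surj by (metis SigmaE2 subsetD)
  then obtain i where "i \<in> I" "u = v(i := u i)"
    using arc_direction assms by metis
  then show ?thesis
    using that vu assms P_component unfolding direction_def by metis
qed

lemma direction_exists:
  assumes "P \<noteq> {}" "i \<in> I" "b \<in> A i" "c \<in> A i" "b \<noteq> c"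
  obtains m m' where "(m, m') \<in> Z" "direction i (lab m m')"
proof -
  obtain d where "d \<in> A i" "r i b d" "r i c d"
    using r_directed assms by blast
  \<comment> \<open>The bound \<open>d\<close> cannot equal both \<open>b\<close> and
    \<open>c\<close>, so one of them lies strictly below it.\<close>
  then obtain a where a: "a \<in> A i" "r i a d" "a \<noteq> d"
    using assms by metis
  obtain u where u: "u \<in> P"
    using assms by auto
  let ?u = "u(i := a)" and ?v = "u(i := d)"
  have P: "?u \<in> P" "?v \<in> P"
    using u a assms \<open>d \<in> A i\<close> by (simp_all only: upd_in_P)
  have "?u \<preceq> ?v"
    using a u by (auto simp: below_def intro: r_refl P_component)
  moreover have "?u \<noteq> ?v"
    using a by (metis fun_upd_same)
  ultimately obtain w where w: "w \<in> P" "(k ?v, k w) \<in> Z" "?u \<preceq> w" "w \<preceq> ?v"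
    using first_arc P by metis
  have "w = ?v(i := w i)"
    using between_upd[of w ?v i a] w P assms by simp
  then have "direction i (lab (k ?v) (k w))"
    unfolding direction_def using w P P_component assms by metis
  then show ?thesis
    using that w by blast
qed

text \<open>Labels of different components are brought together at one element, which takes
  component \<open>i\<close> from \<open>v\<close> and component \<open>j\<close> from
  \<open>v'\<close>. The square there shows that \<open>g\<close> is still available after
  \<open>f\<close>.\<close>

lemma direction_square:
  assumes "direction i f" "direction j g" "i \<in> I" "j \<in> I" "i \<noteq> j"
  obtains m m1 m2 m3 where "(m, m1) \<in> Z" "(m, m2) \<in> Z" "(m1, m3) \<in> Z"
    "lab m m1 = f" "lab m m2 = g" "lab m1 m3 = g"
proof -
  obtain v a where v: "v \<in> P" "a \<in> A i" "(k v, k (v(i := a))) \<in> Z"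
      "lab (k v) (k (v(i := a))) = f"
    using assms unfolding direction_def by blast
  obtain v' c where v': "v' \<in> P" "c \<in> A j" "(k v', k (v'(j := c))) \<in> Z"
      "lab (k v') (k (v'(j := c))) = g"
    using assms unfolding direction_def by blast
  define u where "u = v(j := v' j)"
  have u: "u \<in> P" "u i = v i" "u j = v' j"
    using v v' assms P_component upd_in_P by (simp_all add: u_def)
  have arcs: "(k u, k (u(i := a))) \<in> Z" "(k u, k (u(j := c))) \<in> Z"
    using shift_arc u v v' assms by metis+
  have labs: "lab (k u) (k (u(i := a))) = f" "lab (k u) (k (u(j := c))) = g"
    using label_independent u v v' assms by metis+
  have uj: "u(j := c) \<in> P" "(u(j := c)) i = u i"
    using u v' assms upd_in_P by simp_all
  show ?thesis
    using that arcs labs square(1,3)[OF arcs(1) assms(3) v(2) u(1) uj arcs(2)] by metis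
qed

end

section \<open>Winding numbers of cycles composed of arcs\<close>

text \<open>The path \<open>p\<close> followed by the reverse of \<open>q\<close> is a loop inside
  an arc. An arc has empty inside, so this loop does not wind around \<open>z\<close>.\<close>

lemma winding_number_eq_in_arc:
  assumes g: "arc g" and z: "z \<notin> path_image g"
    and p: "path p" "path_image p \<subseteq> path_image g"
    and q: "path q" "path_image q \<subseteq> path_image g"
    and ends: "pathstart p = pathstart q" "pathfinish p = pathfinish q"
  shows "winding_number p z = winding_number q z"
proof -
  let ?l = "p +++ reversepath q"
  have "path_image ?l \<subseteq> path_image g"
    using p q ends by (simp add: path_image_join)
  moreover have "z \<in> outside (path_image g)"
    using z inside_arc_empty[OF g] by (simp add: outside_inside)
  ultimately have "z \<in> outside (path_image ?l)"
    using outside_mono by blast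
  then have "winding_number ?l z = 0"
    using p q ends by (intro winding_number_zero_in_outside) auto
  moreover have "winding_number ?l z = winding_number p z - winding_number q z"
  proof -
    have "z \<notin> path_image p" "z \<notin> path_image q"
      using p q z by auto
    then show ?thesis
      using p q ends by (simp add: winding_number_join winding_number_reversepath)
  qed
  ultimately show ?thesis by simp
qed

text \<open>Joins consecutive edges into a single path within \<open>A\<close>, to which
  \<open>winding_number_eq_in_arc\<close> can then be applied.\<close>

lemma winding_number_chain:
  fixes c :: "nat \<Rightarrow> real \<Rightarrow> complex"
  assumes "\<And>i. path (c i)" "\<And>i. pathfinish (c i) = pathstart (c (Suc i))"
    and "\<And>i. a \<le> i \<Longrightarrow> i \<le> a + m \<Longrightarrow> path_image (c i) \<subseteq> A" and "z \<notin> A"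
  shows "\<exists>r. path r \<and> path_image r \<subseteq> A \<and> pathstart r = pathstart (c a) \<and>
             pathfinish r = pathfinish (c (a + m)) \<and>
             winding_number r z = (\<Sum>i=a..a + m. winding_number (c i) z)"
  using assms(3)
proof (induction m)
  case 0
  then show ?case
    using assms(1) by (intro exI[of _ "c a"]) simp
next
  case (Suc m)
  then obtain r where r: "path r" "path_image r \<subseteq> A" "pathstart r = pathstart (c a)"
      "pathfinish r = pathfinish (c (a + m))"
      "winding_number r z = (\<Sum>i=a..a + m. winding_number (c i) z)"
    by auto
  let ?c = "c (a + Suc m)"
  have c: "path ?c" "path_image ?c \<subseteq> A" "pathfinish r = pathstart ?c"
    using assms(1,2) Suc.prems r by auto
  have "winding_number (r +++ ?c) z = (\<Sum>i=a..a + Suc m. winding_number (c i) z)"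
    using r c assms(4) by (subst winding_number_join) auto
  then show ?case
    using r c by (intro exI[of _ "r +++ ?c"]) (auto simp: path_image_join)
qed

text \<open>
  The loop \<open>q\<close> runs through \<open>c k\<close> and then through an arc that contains the rest of the
  cycle; inside an arc the winding number only depends on the end points.
\<close>

lemma winding_number_cycle:
  fixes c :: "nat \<Rightarrow> real \<Rightarrow> complex"
  assumes q: "simple_path q" "pathfinish q = pathstart q" and \<tau>: "0 < \<tau>" "\<tau> \<le> 1"
    and qc: "q ` {0..\<tau>} = path_image (c k)"
      "{q 0, q \<tau>} = {pathstart (c k), pathfinish (c k)}" "q 0 \<noteq> q \<tau>"
    and c: "\<And>i. path (c i)" "\<And>i. pathfinish (c i) = pathstart (c (Suc i))"
    and n: "2 \<le> n" "pathstart (c (k + n)) = pathstart (c k)" and arc: "arc (c k)"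
    and sub: "\<And>i. path_image (c i) \<subseteq> path_image q"
    and disj: "\<And>i. k < i \<Longrightarrow> i < k + n \<Longrightarrow>
      path_image (c i) \<inter> path_image (c k) \<subseteq> {pathstart (c k), pathfinish (c k)}"
    and z: "z \<notin> path_image q"
  shows "(\<Sum>i=k..<k + n. winding_number (c i) z) =
           (if q 0 = pathstart (c k) then winding_number q z else - winding_number q z)"
proof -
  \<comment> \<open>The part of the loop after the edge \<open>c k\<close>: an arc from
    \<open>q \<tau>\<close> back to \<open>q 0\<close>.\<close>
  define R where "R = subpath \<tau> 1 q"
  have pq: "path q"
    using q by (simp add: simple_path_imp_path)
  have q1: "q 1 = q 0"
    using q by (simp add: pathfinish_def pathstart_def)
  have R: "arc R"
    unfolding R_def using q \<tau> qc(3) q1 by (intro arc_simple_path_subpath) auto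
  have imR: "path_image R = q ` {\<tau>..1}"
    using \<tau> by (simp add: R_def path_image_subpath)
  have subR: "path_image R \<subseteq> path_image q"
    using \<tau> unfolding imR by (auto simp: path_image_def)
  then have zR: "z \<notin> path_image R"
    using z by auto
  have zc: "z \<notin> path_image (c i)" for i
    using sub z by auto
  have ends: "pathstart R = q \<tau>" "pathfinish R = q 0"
    using q1 by (simp_all add: R_def)
  \<comment> \<open>Points of other edges that \<open>q\<close> reaches before \<tau> lie on
    \<open>c k\<close> as well; so they are end points of \<open>c k\<close>, hence of
    \<open>R\<close>.\<close>
  have in_R: "path_image (c i) \<subseteq> path_image R" if "Suc k \<le> i" "i \<le> Suc k + (n - 2)" for i
  proof
    fix y assume y: "y \<in> path_image (c i)"
    then obtain u where u: "u \<in> {0..1}" "y = q u"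
      using sub unfolding path_image_def by blast
    show "y \<in> path_image R"
    proof (cases "\<tau> \<le> u")
      case True
      then show ?thesis using u by (auto simp: imR)
    next
      case False
      then have "y \<in> path_image (c k)"
        using u unfolding qc(1)[symmetric] by auto
      moreover have "k < i" "i < k + n"
        using that n by auto
      ultimately have "y \<in> {q 0, q \<tau>}"
        using disj y qc(2) by blast
      then show ?thesis
        using pathstart_in_path_image[of R] pathfinish_in_path_image[of R] ends by auto
    qed
  qed
  obtain r where r: "path r" "path_image r \<subseteq> path_image R" "pathstart r = pathstart (c (Suc k))"
      "pathfinish r = pathfinish (c (Suc k + (n - 2)))"
      "winding_number r z = (\<Sum>i=Suc k..Suc k + (n - 2). winding_number (c i) z)"
    using winding_number_chain[of c "Suc k" "n - 2", OF c in_R zR] by blast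
  \<comment> \<open>The remaining edges have the indices \<open>Suc k\<close> to
    \<open>k + n - 1\<close>, and the last one ends where \<open>c k\<close> starts.\<close>
  have idx: "Suc (Suc k + (n - 2)) = k + n"
    using n by simp
  have r_ends: "pathstart r = pathfinish (c k)" "pathfinish r = pathstart (c k)"
    using r(3,4) c(2)[of k] c(2)[of "Suc k + (n - 2)"] n(2) unfolding idx by simp_all
  have set: "{k..<k + n} = insert k {Suc k..Suc k + (n - 2)}"
    using n by auto
  have sum: "(\<Sum>i=k..<k + n. winding_number (c i) z) = winding_number (c k) z + winding_number r z"
    unfolding set r(5) by simp
  have "winding_number (subpath 0 \<tau> q) z + winding_number (subpath \<tau> 1 q) z
      = winding_number (subpath 0 1 q) z"
    using \<tau> z pq by (intro winding_number_subpath_combine) auto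
  then have split: "winding_number q z = winding_number (subpath 0 \<tau> q) z + winding_number R z"
    by (simp add: R_def)
  have s: "path (subpath 0 \<tau> q)" "path_image (subpath 0 \<tau> q) \<subseteq> path_image (c k)"
      "pathstart (subpath 0 \<tau> q) = q 0" "pathfinish (subpath 0 \<tau> q) = q \<tau>"
    using \<tau> pq qc(1) by (auto simp: path_image_subpath)
  have pR: "path R"
    using R by (rule arc_imp_path)
  show ?thesis
  proof (cases "q 0 = pathstart (c k)")
    case True
    then have "q \<tau> = pathfinish (c k)"
      using qc by (metis doubleton_eq_iff)
    then have "winding_number (subpath 0 \<tau> q) z = winding_number (c k) z"
      using True s zc c by (intro winding_number_eq_in_arc[OF arc]) auto
    moreover have "winding_number R z = winding_number r z"
      using True \<open>q \<tau> = _\<close> r r_ends ends zR pR by (intro winding_number_eq_in_arc[OF R]) auto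
    ultimately show ?thesis
      using True sum split by simp
  next
    case False
    then have *: "q 0 = pathfinish (c k)" "q \<tau> = pathstart (c k)"
      using qc by (metis doubleton_eq_iff)+
    then have "winding_number (subpath 0 \<tau> q) z = winding_number (reversepath (c k)) z"
      using s zc c by (intro winding_number_eq_in_arc[OF arc]) auto
    moreover have "winding_number R z = winding_number (reversepath r) z"
      using * r r_ends ends zR pR by (intro winding_number_eq_in_arc[OF R]) auto
    ultimately show ?thesis
      using False sum split zc c r zR by (subst (asm) (1 2) winding_number_reversepath) auto
  qed
qed

text \<open>Moves the start of the traversal to \<open>x\<close>, so that the edge fills an initial
  parameter interval, and adds the winding number 0 outside the curve.\<close>

lemma goes_clockwiseE:
  assumes "goes_clockwise C e x y"
  obtains q \<tau> where "simple_path q" "pathfinish q = pathstart q" "path_image q = \<Union>C"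
    "0 < \<tau>" "\<tau> \<le> 1" "q 0 = x" "q \<tau> = y" "q ` {0..\<tau>} = e"
    "\<And>z. z \<notin> \<Union>C \<Longrightarrow> winding_number q z = (if z \<in> inside (\<Union>C) then - 1 else 0)"
proof -
  obtain p s t where p: "clockwise_loop p" "path_image p = \<Union>C" and st: "0 \<le> s" "s < t" "t \<le> 1"
      and e: "p s = x" "p t = y" "p ` {s..t} = e"
    using assms unfolding goes_clockwise_def by blast
  have sp: "simple_path p" "pathfinish p = pathstart p"
      and wn: "\<And>z. z \<in> inside (path_image p) \<Longrightarrow> winding_number p z = - 1"
    using p unfolding clockwise_loop_def by auto
  have s: "s \<in> {0..1}"
    using st by auto
  let ?q = "shiftpath s p"
  have q: "?q u = p (s + u)" if "u \<in> {0..t - s}" for u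
    using that st by (auto simp: shiftpath_def)
  have img: "?q ` {0..t - s} = e"
  proof -
    have "?q ` {0..t - s} = p ` ((\<lambda>u. s + u) ` {0..t - s})"
      unfolding image_image using q by (intro image_cong) auto
    also have "(\<lambda>u. s + u) ` {0..t - s} = {s..t}"
      by simp
    finally show ?thesis using e by simp
  qed
  show ?thesis
  proof (rule that[of ?q "t - s"])
    show "simple_path ?q"
      using sp st by (intro simple_path_shiftpath) auto
    show "pathfinish ?q = pathstart ?q"
      using sp s by (intro closed_shiftpath) auto
    show "path_image ?q = \<Union>C"
      using path_image_shiftpath[OF s sp(2)] p by simp
    show "winding_number ?q z = (if z \<in> inside (\<Union>C) then - 1 else 0)" if z: "z \<notin> \<Union>C" for z
    proof -
      have "winding_number ?q z = winding_number p z"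
        using sp s z p by (intro winding_number_shiftpath) (auto simp: simple_path_imp_path)
      also have "\<dots> = (if z \<in> inside (\<Union>C) then - 1 else 0)"
      proof (cases "z \<in> inside (\<Union>C)")
        case False
        then have "z \<in> outside (path_image p)"
          using z p by (simp add: outside_inside)
        then show ?thesis
          using False sp by (simp add: winding_number_zero_in_outside simple_path_imp_path)
      qed (use wn p in auto)
      finally show ?thesis .
    qed
  qed (use st q e img in auto)
qed

text \<open>The curve is the frontier of \<open>F\<close>, so a connected set that misses the curve
  and meets \<open>F\<close> lies in \<open>F\<close>. The unbounded outside therefore misses
  \<open>F\<close>, and the inside is contained in it.\<close>

lemma component_eq_inside:
  fixes p :: "real \<Rightarrow> complex"
  assumes p: "simple_path p" "pathfinish p = pathstart p"
    and F: "connected F" "F \<noteq> {}" "bounded F" "F \<inter> path_image p = {}" "frontier F = path_image p"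
  shows "F = inside (path_image p)"
proof -
  let ?K = "path_image p"
  note J = Jordan_inside_outside[OF p]
  have sub: "D \<subseteq> F" if "connected D" "D \<inter> ?K = {}" "D \<inter> F \<noteq> {}" for D
    using connected_Int_frontier[of D F] that F by auto
  have "outside ?K \<inter> F = {}"
    using sub[of "outside ?K"] J F bounded_subset by (metis outside_no_overlap)
  then have "F \<subseteq> inside ?K"
    using F J by blast
  moreover have "inside ?K \<subseteq> F"
    using sub[of "inside ?K"] J F calculation by auto
  ultimately show ?thesis by auto
qed

text \<open>Allows a cycle to be read from any of its edges on.\<close>

lemma cyclic_window_bij:
  assumes "distinct es" "0 < length es" "k < length es"
  shows "bij_betw (\<lambda>i. es ! (i mod length es)) {k..<k + length es} (set es)"
proof -
  let ?n = "length es"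
  have inj: "inj_on (\<lambda>i. es ! (i mod ?n)) {k..<k + ?n}"
  proof (rule inj_onI)
    fix i j assume ij: "i \<in> {k..<k + ?n}" "j \<in> {k..<k + ?n}" "es ! (i mod ?n) = es ! (j mod ?n)"
    then have "i mod ?n = j mod ?n"
      using assms by (simp add: nth_eq_iff_index_eq)
    moreover have "i mod ?n = (if i < ?n then i else i - ?n)" "j mod ?n = (if j < ?n then j else j - ?n)"
      using ij assms by (auto simp: mod_if)
    ultimately show "i = j"
      using ij by (auto split: if_splits)
  qed
  have "(\<lambda>i. es ! (i mod ?n)) ` {k..<k + ?n} = set es"
  proof (rule card_subset_eq)
    show "(\<lambda>i. es ! (i mod ?n)) ` {k..<k + ?n} \<subseteq> set es"
      using assms by auto
    show "card ((\<lambda>i. es ! (i mod ?n)) ` {k..<k + ?n}) = card (set es)"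
      using assms card_image[OF inj] by (simp add: distinct_card)
  qed simp
  with inj show ?thesis
    by (simp add: bij_betw_def)
qed

section \<open>Flips in plane bipartite graphs\<close>

locale plane_bipartite =
  fixes V W B :: "complex set" and E :: "complex set set"
  assumes plane: "plane_graph V E" and coloring: "proper_two_coloring V E W B"
begin

section \<open>Edges as arcs from white to black\<close>

lemma finite_E: "finite E"
  using plane by (simp add: plane_graph_def)

lemma edges_meet_in_V: "e \<in> E \<Longrightarrow> e' \<in> E \<Longrightarrow> e \<noteq> e' \<Longrightarrow> e \<inter> e' \<subseteq> V"
  using plane by (auto simp: plane_graph_def)

lemma colors: "W \<subseteq> V" "B \<subseteq> V" "W \<inter> B = {}"
  using coloring unfolding proper_two_coloring_def by auto

lemma edge_path_exists:
  assumes "e \<in> E"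
  shows "\<exists>g. arc g \<and> path_image g = e \<and> e \<inter> V = {pathstart g, pathfinish g} \<and>
             pathstart g \<in> W \<and> pathfinish g \<in> B"
proof -
  obtain g where g: "arc g" "path_image g = e" "e \<inter> V = {pathstart g, pathfinish g}"
    using plane assms by (auto simp: plane_graph_def)
  obtain w b where wb: "w \<in> W" "b \<in> B" "e \<inter> V = {w, b}"
    using coloring assms by (auto simp: proper_two_coloring_def)
  then consider "pathstart g = w" "pathfinish g = b" | "pathstart g = b" "pathfinish g = w"
    using g by (metis doubleton_eq_iff)
  then show ?thesis
  proof cases
    case 1
    then show ?thesis using g wb by blast
  next
    case 2
    then show ?thesis
      using g wb by (intro exI[of _ "reversepath g"]) (simp add: arc_reversepath insert_commute)
  qed
qed

definition edge_path :: "complex set \<Rightarrow> real \<Rightarrow> complex" where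
  "edge_path e = (SOME g. arc g \<and> path_image g = e \<and> e \<inter> V = {pathstart g, pathfinish g} \<and>
                          pathstart g \<in> W \<and> pathfinish g \<in> B)"

lemma edge_path:
  assumes "e \<in> E"
  shows "arc (edge_path e)" "path_image (edge_path e) = e"
    "e \<inter> V = {pathstart (edge_path e), pathfinish (edge_path e)}"
    "pathstart (edge_path e) \<in> W" "pathfinish (edge_path e) \<in> B"
  using someI_ex[OF edge_path_exists[OF assms]] unfolding edge_path_def[symmetric] by simp_all

definition edge_winding :: "complex set \<Rightarrow> complex \<Rightarrow> complex" where
  "edge_winding e z = winding_number (edge_path e) z"

text \<open>An edge is infinite but contains finitely many vertices, so it has a point off
  \<open>V\<close>, which lies on no other edge. Thus a union of edges determines these
  edges.\<close>

lemma edge_subset_Union_iff: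
  assumes "e \<in> E" "C \<subseteq> E"
  shows "e \<subseteq> \<Union>C \<longleftrightarrow> e \<in> C"
proof
  assume sub: "e \<subseteq> \<Union>C"
  have "inj_on (edge_path e) {0..1}"
    using edge_path(1)[OF assms(1)] by (simp add: arc_def)
  then have "infinite (edge_path e ` {0..1})"
    by (simp add: finite_image_iff infinite_Icc)
  then have "infinite e"
    using edge_path(2)[OF assms(1)] by (simp add: path_image_def)
  moreover have "finite (e \<inter> V)"
    using plane by (simp add: plane_graph_def)
  ultimately have "\<not> e \<subseteq> V"
    by (metis inf.absorb1)
  then obtain y where y: "y \<in> e" "y \<notin> V"
    by blast
  then obtain d where d: "d \<in> C" "y \<in> d"
    using sub by blast
  then have "e = d"
    using edges_meet_in_V[of e d] y assms by blast
  then show "e \<in> C"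
    using d by simp
qed auto

lemma one_factor_unique:
  assumes "M \<in> one_factors V E" "v \<in> V" "e \<in> M" "v \<in> e" "e' \<in> M" "v \<in> e'"
  shows "e = e'"
  using assms unfolding one_factors_def by blast

section \<open>Signed winding numbers along alternating cycles\<close>

text \<open>Colors and membership in \<open>M\<close> alternate, so if one \<open>M\<close>-edge is
  run clockwise from white to black, all are, and the other edges from black to white. The signed
  sum is then the winding number of the clockwise traversal.\<close>

lemma alternating_sum:
  assumes cyc: "cycle_seq V E vs es"
    and alt: "\<forall>i<length es. es ! i \<in> M \<longleftrightarrow> es ! (Suc i mod length es) \<notin> M"
    and e: "e \<in> set es" "e \<in> M" and go: "goes_clockwise (set es) e w b" "w \<in> W" "b \<in> B"
    and z: "z \<notin> \<Union>(set es)"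
  shows "(\<Sum>e\<in>set es. if e \<in> M then edge_winding e z else - edge_winding e z) =
           (if z \<in> inside (\<Union>(set es)) then - 1 else 0)"
proof -
  define n where "n = length es"
  \<comment> \<open>Periodic sequences replace the lists, so that the cycle can start at any
    index.\<close>
  define v where "v i = vs ! (i mod n)" for i
  define d where "d i = es ! (i mod n)" for i
  have n: "2 \<le> n" "length vs = n" "distinct vs" "distinct es" "set es \<subseteq> E"
    using cyc unfolding cycle_seq_def n_def by auto
  have d_in: "d i \<in> set es" for i
    using n unfolding d_def n_def by (intro nth_mem mod_less_divisor) auto
  then have dE: "d i \<in> E" for i
    using n by blast
  have dV: "d i \<inter> V = {v i, v (Suc i)}" for i
  proof -
    have "i mod n < n"
      using n by auto
    then have "es ! (i mod n) \<inter> V = {vs ! (i mod n), vs ! (Suc (i mod n) mod n)}"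
      using cyc unfolding cycle_seq_def n_def by blast
    then show ?thesis
      by (simp add: v_def d_def mod_Suc_eq)
  qed
  have dM: "d i \<in> M \<longleftrightarrow> d (Suc i) \<notin> M" for i
  proof -
    have "i mod n < n"
      using n by auto
    then have "es ! (i mod n) \<in> M \<longleftrightarrow> es ! (Suc (i mod n) mod n) \<notin> M"
      using alt unfolding n_def by blast
    then show ?thesis
      by (simp add: d_def mod_Suc_eq)
  qed
  \<comment> \<open>Edge paths turned to follow the listing \<open>vs\<close>, which may run either
    way round.\<close>
  define c where "c i = (if v i \<in> W then edge_path (d i) else reversepath (edge_path (d i)))" for i
  note ep = edge_path[OF dE]
  have color: "v i \<in> W \<and> v (Suc i) \<in> B \<and> pathstart (edge_path (d i)) = v i
        \<and> pathfinish (edge_path (d i)) = v (Suc i)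
      \<or> v i \<in> B \<and> v (Suc i) \<in> W \<and> pathstart (edge_path (d i)) = v (Suc i)
        \<and> pathfinish (edge_path (d i)) = v i" for i
    using ep(3-5)[of i] dV[of i] by (metis doubleton_eq_iff)
  have vW: "v i \<in> W \<longleftrightarrow> v (Suc i) \<notin> W" for i
    using color[of i] colors(3) by blast
  have c: "arc (c i)" "path_image (c i) = d i" "pathstart (c i) = v i" "pathfinish (c i) = v (Suc i)"
    for i
    using ep(1,2)[of i] color[of i] colors(3) by (auto simp: c_def arc_reversepath)
  obtain k where k: "k < n" "e = d k"
    using e by (auto simp: in_set_conv_nth d_def n_def)
  obtain q \<tau> where q: "simple_path q" "pathfinish q = pathstart q" "path_image q = \<Union>(set es)"
    "0 < \<tau>" "\<tau> \<le> 1" "q 0 = w" "q \<tau> = b" "q ` {0..\<tau>} = e"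
    "\<And>z. z \<notin> \<Union>(set es) \<Longrightarrow>
       winding_number q z = (if z \<in> inside (\<Union>(set es)) then - 1 else 0)"
    using goes_clockwiseE[OF go(1)] by blast
  have wb: "{w, b} = {v k, v (Suc k)}" "w \<noteq> b"
  proof -
    show "w \<noteq> b"
      using go colors by blast
    have "w \<in> e" "b \<in> e"
      using q(4-8) by auto
    then have "{w, b} \<subseteq> {v k, v (Suc k)}"
      using dV[of k] go colors k by blast
    with \<open>w \<noteq> b\<close> show "{w, b} = {v k, v (Suc k)}"
      by auto
  qed
  have bij: "bij_betw d {k..<k + n} (set es)"
    unfolding d_def n_def by (rule cyclic_window_bij) (use n k in \<open>auto simp: n_def\<close>)
  have cyc_sum: "(\<Sum>i=k..<k + n. winding_number (c i) z) =
      (if q 0 = pathstart (c k) then winding_number q z else - winding_number q z)"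
  proof (rule winding_number_cycle)
    show "pathstart (c (k + n)) = pathstart (c k)"
      by (simp add: c v_def)
    show "path_image (c i) \<subseteq> path_image q" for i
      using c q d_in by auto
    show "path_image (c i) \<inter> path_image (c k) \<subseteq> {pathstart (c k), pathfinish (c k)}"
      if "k < i" "i < k + n" for i
    proof -
      have "d i \<noteq> d k"
        using bij_betw_imp_inj_on[OF bij] that by (auto dest: inj_onD)
      then show ?thesis
        using edges_meet_in_V[OF dE dE, of i k] dV[of k] c by auto
    qed
    show "q ` {0..\<tau>} = path_image (c k)" "{q 0, q \<tau>} = {pathstart (c k), pathfinish (c k)}"
        "q 0 \<noteq> q \<tau>"
      using q wb k c by auto
    show "path (c i)" for i
      using c(1) by (rule arc_imp_path)
  qed (use q n c z in auto)
  \<comment> \<open>Color and membership both alternate, so their agreement is the same at every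
    index; at \<open>k\<close> it is decided by \<open>e \<in> M\<close>.\<close>
  have const: "(v i \<in> W \<longleftrightarrow> d i \<in> M) \<longleftrightarrow> v k \<in> W" if "k \<le> i" for i
    using that
  proof (induction rule: dec_induct)
    case base
    then show ?case using e k by simp
  next
    case (step i)
    then show ?case using vW[of i] dM[of i] by blast
  qed
  let ?f = "\<lambda>e. if e \<in> M then edge_winding e z else - edge_winding e z"
  have wn: "winding_number (c i) z = (if v k \<in> W then ?f (d i) else - ?f (d i))" if "k \<le> i" for i
  proof -
    have "z \<notin> path_image (edge_path (d i))" "path (edge_path (d i))"
      using ep(1,2)[of i] z d_in[of i] by (auto simp: arc_imp_path)
    then have "winding_number (c i) z =
        (if v i \<in> W then edge_winding (d i) z else - edge_winding (d i) z)"
      by (simp add: c_def edge_winding_def winding_number_reversepath)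
    then show ?thesis
      using const[OF that] by auto
  qed
  have "(\<Sum>i=k..<k + n. winding_number (c i) z) =
      (\<Sum>i=k..<k + n. if v k \<in> W then ?f (d i) else - ?f (d i))"
    using wn by (intro sum.cong) auto
  also have "\<dots> = (if v k \<in> W then \<Sum>i=k..<k + n. ?f (d i) else - (\<Sum>i=k..<k + n. ?f (d i)))"
    by (cases "v k \<in> W") (simp_all only: sum_negf if_True if_False)
  also have "(\<Sum>i=k..<k + n. ?f (d i)) = (\<Sum>e\<in>set es. ?f e)"
    using sum.reindex_bij_betw[OF bij] .
  finally have "(if v k \<in> W then \<Sum>e\<in>set es. ?f e else - (\<Sum>e\<in>set es. ?f e)) =
      (if q 0 = pathstart (c k) then winding_number q z else - winding_number q z)"
    using cyc_sum by simp
  \<comment> \<open>Since \<open>q\<close> starts at the white vertex \<open>w\<close>, the two case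
    distinctions coincide: a listing against the traversal changes the sign on both sides.\<close>
  moreover have "q 0 = pathstart (c k) \<longleftrightarrow> v k \<in> W"
    using q(6) c(3) wb go vW[of k] colors(3) by (auto simp: doubleton_eq_iff)
  ultimately have "(\<Sum>e\<in>set es. ?f e) = winding_number q z"
    by (auto split: if_splits)
  then show ?thesis
    using q(9)[OF z] by simp
qed

lemma alternating_cycle_meets:
  assumes "cycle_seq V E vs es"
    and "\<forall>i<length es. es ! i \<in> M \<longleftrightarrow> es ! (Suc i mod length es) \<notin> M"
  shows "\<exists>e\<in>set es. e \<in> M"
proof -
  have "0 < length es" "Suc 0 mod length es < length es"
    using assms by (auto simp: cycle_seq_def)
  then show ?thesis
    using assms(2) by (metis nth_mem)
qed

lemma proper_alternating_sum:
  assumes "proper_alternating V E W B M C" "z \<notin> \<Union>C"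
  shows "(\<Sum>e\<in>C. if e \<in> M then edge_winding e z else - edge_winding e z) =
           (if z \<in> inside (\<Union>C) then - 1 else 0)"
proof -
  obtain vs es where es: "cycle_seq V E vs es" "set es = C"
      "\<forall>i<length es. es ! i \<in> M \<longleftrightarrow> es ! (Suc i mod length es) \<notin> M"
    using assms unfolding proper_alternating_def alternating_cycle_def by blast
  obtain e where e: "e \<in> set es" "e \<in> M"
    using alternating_cycle_meets es by blast
  then obtain w b where "w \<in> W" "b \<in> B" "goes_clockwise (set es) e w b"
    using assms es unfolding proper_alternating_def by blast
  then show ?thesis
    using alternating_sum[OF es(1,3) e] assms es by simp
qed

lemma proper_alternating_loop:
  assumes "proper_alternating V E W B M C"
  obtains p where "simple_path p" "pathfinish p = pathstart p" "path_image p = \<Union>C"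
proof -
  obtain vs es where es: "cycle_seq V E vs es" "set es = C"
      "\<forall>i<length es. es ! i \<in> M \<longleftrightarrow> es ! (Suc i mod length es) \<notin> M"
    using assms unfolding proper_alternating_def alternating_cycle_def by blast
  then obtain e where "e \<in> C \<inter> M"
    using alternating_cycle_meets by blast
  then obtain w b where "goes_clockwise C e w b"
    using assms unfolding proper_alternating_def by blast
  then show ?thesis
    using that goes_clockwiseE by metis
qed

section \<open>Heights and flipped faces\<close>

abbreviation Z where "Z \<equiv> Z_digraph V E W B"

text \<open>An explicit candidate for the face whose existence \<open>Z_digraph\<close> asserts;
  Jordan's theorem later identifies the two.\<close>

definition flipped_face :: "complex set set \<Rightarrow> complex set set \<Rightarrow> complex set" where
  "flipped_face M N = inside (\<Union>(sym_diff M N))"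

text \<open>Winding numbers of open arcs are complex in general; the real part suffices because
  heights change by 0 or 1 along arcs of \<open>Z\<close>. With the default 0 the law in
  \<open>height_arc\<close> holds for every set \<open>F\<close>.\<close>

definition height :: "complex set set \<Rightarrow> complex set \<Rightarrow> real" where
  "height M F =
     (if F \<in> inner_faces V E then Re (\<Sum>e\<in>M. edge_winding e (SOME z. z \<in> F)) else 0)"

lemma Z_factors:
  assumes "(M, N) \<in> Z"
  shows "M \<in> one_factors V E" "N \<in> one_factors V E" "sym_diff M N \<subseteq> E"
    "proper_alternating V E W B M (sym_diff M N)"
  using assms unfolding Z_digraph_def one_factors_def by auto

lemma flipped_face:
  assumes "(M, N) \<in> Z"
  shows "flipped_face M N \<in> inner_faces V E" "frontier (flipped_face M N) = \<Union>(sym_diff M N)"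
proof -
  let ?C = "sym_diff M N"
  obtain F where F: "F \<in> inner_faces V E" "frontier F = \<Union>?C"
    using assms unfolding Z_digraph_def by blast
  obtain p where p: "simple_path p" "pathfinish p = pathstart p" "path_image p = \<Union>?C"
    using proper_alternating_loop Z_factors(4)[OF assms] by blast
  have comp: "F \<in> components (- (V \<union> \<Union>E))" "bounded F"
    using F unfolding inner_faces_def by auto
  have "F = inside (path_image p)"
  proof (rule component_eq_inside[OF p(1,2)])
    show "F \<inter> path_image p = {}"
      using in_components_subset[OF comp(1)] Z_factors(3)[OF assms] p(3) by blast
    show "connected F" "F \<noteq> {}"
      using comp(1) by (simp_all only: in_components_connected in_components_nonempty not_False_eq_True)
  qed (simp_all add: comp F p del: Union_Un_distrib)
  then have "flipped_face M N = F"
    by (simp add: flipped_face_def p)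
  then show "flipped_face M N \<in> inner_faces V E" "frontier (flipped_face M N) = \<Union>?C"
    using F by auto
qed

lemma sym_diff_flipped_face:
  assumes "(M, N) \<in> Z"
  shows "sym_diff M N = {e \<in> E. e \<subseteq> frontier (flipped_face M N)}"
proof -
  note sub = Z_factors(3)[OF assms]
  have "e \<in> sym_diff M N \<longleftrightarrow> e \<in> E \<and> e \<subseteq> \<Union>(sym_diff M N)" for e
    using edge_subset_Union_iff[OF _ sub, of e] sub by blast
  then show ?thesis
    unfolding flipped_face(2)[OF assms] by blast
qed

text \<open>Common edges cancel in the difference of the two sums, which leaves the signed sum along
  the flipped cycle: -1 inside and 0 outside for \<open>M\<close> minus \<open>N\<close>.\<close>

lemma height_arc:
  assumes "(M, N) \<in> Z"
  shows "height N F = height M F + (if F = flipped_face M N then 1 else 0)"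
proof (cases "F \<in> inner_faces V E")
  case True
  let ?C = "sym_diff M N"
  define z where "z = (SOME z. z \<in> F)"
  have F: "F \<in> components (- (V \<union> \<Union>E))"
    using True unfolding inner_faces_def by auto
  have zF: "z \<in> F"
    unfolding z_def using in_components_nonempty[OF F] by (simp add: some_in_eq)
  then have z: "z \<notin> \<Union>?C"
    using in_components_subset[OF F] Z_factors(3)[OF assms] by blast
  have fin: "finite M" "finite N"
    using Z_factors[OF assms] finite_E finite_subset unfolding one_factors_def by auto
  let ?w = "\<lambda>e. edge_winding e z"
  have "(\<Sum>e\<in>?C. if e \<in> M then ?w e else - ?w e) =
      (\<Sum>e\<in>M - N. if e \<in> M then ?w e else - ?w e) + (\<Sum>e\<in>N - M. if e \<in> M then ?w e else - ?w e)"
    using fin by (intro sum.union_disjoint) auto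
  also have "\<dots> = sum ?w (M - N) + (\<Sum>e\<in>N - M. - ?w e)"
    by (intro arg_cong2[where f = "(+)"] sum.cong) auto
  also have "\<dots> = sum ?w M - sum ?w N"
    using fin sum.Int_Diff[of M ?w N] sum.Int_Diff[of N ?w M]
    by (simp add: sum_negf Int_commute)
  finally have "sum ?w N = sum ?w M + (if z \<in> flipped_face M N then 1 else 0)"
    using proper_alternating_sum[OF Z_factors(4)[OF assms] z]
    by (auto simp: flipped_face_def algebra_simps split: if_splits)
  \<comment> \<open>Both sets are components of the complement of the graph, so they coincide once
    they share \<open>z\<close>.\<close>
  moreover have "z \<in> flipped_face M N \<longleftrightarrow> F = flipped_face M N"
    using zF components_nonoverlap[OF F, of "flipped_face M N"] flipped_face(1)[OF assms]
    unfolding inner_faces_def by blast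
  ultimately show ?thesis
    using True by (simp add: height_def z_def)
next
  case False
  then show ?thesis
    using flipped_face(1)[OF assms] by (auto simp: height_def)
qed

lemma flipped_face_inj:
  assumes "(M, N) \<in> Z" "(M, N') \<in> Z" "flipped_face M N = flipped_face M N'"
  shows "N = N'"
proof -
  have "sym_diff M N = sym_diff M N'"
    using sym_diff_flipped_face[OF assms(1)] sym_diff_flipped_face[OF assms(2)] assms(3) by simp
  then show ?thesis
    by blast
qed

section \<open>Flips available at a common 1-factor\<close>

text \<open>\<open>alternating_cycle\<close> grants alternation along some listing only; here any
  listing serves, so that two 1-factors can be compared along the same one. Consecutive edges share
  a vertex, at which \<open>M\<close> and \<open>N\<close> have one edge each.\<close>

lemma factor_alternates:
  assumes M: "M \<in> one_factors V E" and N: "N \<in> one_factors V E"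
    and cyc: "cycle_seq V E vs es" and es: "set es = sym_diff M N"
  shows "\<forall>i<length es. es ! i \<in> M \<longleftrightarrow> es ! (Suc i mod length es) \<notin> M"
proof (intro allI impI)
  fix i assume i: "i < length es"
  let ?n = "length es" and ?j = "Suc i mod length es"
  have j: "?j < ?n"
    using i by (intro mod_less_divisor) auto
  have n: "2 \<le> ?n" "distinct es"
    using cyc unfolding cycle_seq_def by auto
  then have "?j \<noteq> i"
    using i by (auto simp: mod_Suc split: if_splits)
  then have ne: "es ! i \<noteq> es ! ?j"
    using n i j by (simp add: nth_eq_iff_index_eq)
  have "es ! i \<inter> V = {vs ! i, vs ! ?j}" "es ! ?j \<inter> V = {vs ! ?j, vs ! (Suc ?j mod ?n)}"
    using cyc i j unfolding cycle_seq_def by blast+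
  then have v: "vs ! ?j \<in> V" "vs ! ?j \<in> es ! i" "vs ! ?j \<in> es ! ?j"
    by blast+
  have "es ! i \<in> sym_diff M N" "es ! ?j \<in> sym_diff M N"
    using i j es nth_mem by blast+
  then show "es ! i \<in> M \<longleftrightarrow> es ! ?j \<notin> M"
    using one_factor_unique[OF M v(1)] one_factor_unique[OF N v(1)] v ne by blast
qed

text \<open>
  A common edge would swap the roles of \<open>M\<close>-edges and non-\<open>M\<close>-edges on the whole second cycle,
  hence reverse its orientation.
\<close>

lemma commuting_flips_disjoint:
  assumes Z: "(M, M1) \<in> Z" "(M, M2) \<in> Z" "(M1, M3) \<in> Z"
    and C: "sym_diff M1 M3 = sym_diff M M2"
  shows "sym_diff M M1 \<inter> sym_diff M M2 = {}"
proof (rule ccontr)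
  let ?C = "sym_diff M M2"
  assume "sym_diff M M1 \<inter> ?C \<noteq> {}"
  then obtain e where e: "e \<in> ?C" "e \<in> M \<longleftrightarrow> e \<notin> M1"
    by blast
  have proper: "proper_alternating V E W B M ?C" "proper_alternating V E W B M1 ?C"
    using Z_factors(4)[OF Z(2)] Z_factors(4)[OF Z(3)] C by simp_all
  obtain vs es where es: "cycle_seq V E vs es" "set es = ?C"
    using proper(1) unfolding proper_alternating_def alternating_cycle_def by blast
  let ?n = "length es"
  have alt: "\<forall>i<?n. es ! i \<in> M \<longleftrightarrow> es ! (Suc i mod ?n) \<notin> M"
    using factor_alternates[OF Z_factors(1,2)[OF Z(2)] es] .
  have alt1: "\<forall>i<?n. es ! i \<in> M1 \<longleftrightarrow> es ! (Suc i mod ?n) \<notin> M1"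
    using factor_alternates[OF Z_factors(1,2)[OF Z(3)] es(1)] es(2) C by simp
  \<comment> \<open>Agreement of \<open>M\<close> and \<open>M1\<close> on an edge is constant along
    the cycle, as both alternate, and it fails at \<open>e\<close>.\<close>
  define P where "P i \<longleftrightarrow> (es ! i \<in> M \<longleftrightarrow> es ! i \<in> M1)" for i
  have step: "P (Suc i) \<longleftrightarrow> P i" if "Suc i < ?n" for i
    using alt[rule_format, of i] alt1[rule_format, of i] that unfolding P_def by auto
  have P0: "P i \<longleftrightarrow> P 0" if "i < ?n" for i
    using that by (induction i) (auto simp: step)
  obtain k where k: "k < ?n" "e = es ! k"
    using e(1) es(2) by (metis in_set_conv_nth)
  then have "\<not> P k"
    using e(2) unfolding P_def by simp
  then have swap: "d \<in> M1 \<longleftrightarrow> d \<notin> M" if "d \<in> ?C" for d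
    using that P0 k(1) es(2) unfolding P_def by (metis in_set_conv_nth)
  obtain p where p: "simple_path p" "pathfinish p = pathstart p" "path_image p = \<Union>?C"
    using proper_alternating_loop[OF proper(1)] by blast
  then obtain z where z: "z \<in> inside (\<Union>?C)"
    using Jordan_inside_outside[OF p(1,2)] by (metis ex_in_conv)
  then have "z \<notin> \<Union>?C"
    using inside_no_overlap by blast
  then have "(\<Sum>e\<in>?C. if e \<in> M then edge_winding e z else - edge_winding e z) = - 1"
      "(\<Sum>e\<in>?C. if e \<in> M1 then edge_winding e z else - edge_winding e z) = - 1"
    using proper z by (simp_all add: proper_alternating_sum)
  moreover have "(\<Sum>e\<in>?C. if e \<in> M1 then edge_winding e z else - edge_winding e z) =
      (\<Sum>e\<in>?C. - (if e \<in> M then edge_winding e z else - edge_winding e z))"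
    using swap by (intro sum.cong) auto
  ultimately show False
    by (simp add: sum_negf)
qed

text \<open>Turns a shared vertex into a shared edge: were \<open>m\<close> also in
  \<open>N\<close>, it would be the only edge at \<open>v\<close> in either 1-factor, hence equal to
  \<open>e\<close>.\<close>

lemma factor_edge_in_sym_diff:
  assumes M: "M \<in> one_factors V E" and N: "N \<in> one_factors V E"
    and "e \<in> sym_diff M N" "v \<in> e" "v \<in> V" "m \<in> M" "v \<in> m"
  shows "m \<in> sym_diff M N"
proof (rule ccontr)
  assume "m \<notin> sym_diff M N"
  with \<open>m \<in> M\<close> have "m \<in> N"
    by blast
  then have "e = m"
    using assms one_factor_unique[OF M \<open>v \<in> V\<close>, of e m] one_factor_unique[OF N \<open>v \<in> V\<close>, of e m]
    by blast
  then show False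
    using assms(3) \<open>m \<in> M\<close> \<open>m \<in> N\<close> by blast
qed

lemma rtrancl_flip:
  assumes "(M, N) \<in> Z\<^sup>*" "(e \<in> M) \<noteq> (e \<in> N)"
  obtains M' N' where "(M', N') \<in> Z" "e \<in> sym_diff M' N'"
  using assms
proof (induction arbitrary: thesis rule: rtrancl_induct)
  case (step y z)
  then show ?case by (cases "(e \<in> M) = (e \<in> y)") blast+
qed simp

lemma factor_edge_exists:
  assumes "M \<in> one_factors V E" "v \<in> V"
  obtains m where "m \<in> M" "v \<in> m"
  using assms unfolding one_factors_def by blast

lemma not_product:
  assumes elem: "elementary V E"
    and fp: "flip_product Z (one_factors V E) flipped_face height I A r k"
    and ij: "i \<in> I" "j \<in> I" "i \<noteq> j"
    and nontrivial: "\<And>i. i \<in> I \<Longrightarrow> \<exists>b c. b \<in> A i \<and> c \<in> A i \<and> b \<noteq> c"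
  shows False
proof -
  interpret flip_product Z "one_factors V E" flipped_face height I A r k
    by (fact fp)
  define X where "X l = {e. \<exists>M N. (M, N) \<in> Z \<and> direction l (flipped_face M N) \<and> e \<in> sym_diff M N}"
    for l
  have XE: "X l \<subseteq> E" for l
    unfolding X_def using Z_factors(3) by blast
  have X_disjoint: False
    if l: "l \<in> I" "l' \<in> I" "l \<noteq> l'" and e: "e \<in> X l" "e' \<in> X l'" and v: "v \<in> V" "v \<in> e" "v \<in> e'"
    for l l' e e' v
  proof -
    obtain M N M' N' where MN: "(M, N) \<in> Z" "direction l (flipped_face M N)" "e \<in> sym_diff M N"
        and MN': "(M', N') \<in> Z" "direction l' (flipped_face M' N')" "e' \<in> sym_diff M' N'"
      using e unfolding X_def by blast
    obtain m m1 m2 m3 where Z: "(m, m1) \<in> Z" "(m, m2) \<in> Z" "(m1, m3) \<in> Z"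
        and lab: "flipped_face m m1 = flipped_face M N" "flipped_face m m2 = flipped_face M' N'"
          "flipped_face m1 m3 = flipped_face M' N'"
      using direction_square[OF MN(2) MN'(2) l] .
    \<comment> \<open>A face determines the edges exchanged by its flip, so the cycles at
      \<open>m\<close> are the two given ones.\<close>
    have sd: "sym_diff m m1 = sym_diff M N" "sym_diff m m2 = sym_diff M' N'"
        "sym_diff m1 m3 = sym_diff m m2"
      using Z[THEN sym_diff_flipped_face] MN(1)[THEN sym_diff_flipped_face]
        MN'(1)[THEN sym_diff_flipped_face] lab by simp_all
    obtain d where d: "d \<in> m" "v \<in> d"
      using factor_edge_exists[OF Z_factors(1)[OF Z(1)] v(1)] .
    have "d \<in> sym_diff m m1"
      by (rule factor_edge_in_sym_diff[OF Z_factors(1,2)[OF Z(1)] _ v(2,1) d]) (use MN sd in simp)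
    moreover have "d \<in> sym_diff m m2"
      by (rule factor_edge_in_sym_diff[OF Z_factors(1,2)[OF Z(2)] _ v(3,1) d]) (use MN' sd in simp)
    ultimately show False
      using commuting_flips_disjoint[OF Z sd(3)] by blast
  qed
  have in_factor: "\<exists>M\<in>one_factors V E. e \<in> M" if "e \<in> E" for e
    using elem that unfolding elementary_def by blast
  have in_all: "e \<in> M"
    if e: "e \<in> E" "\<And>l. l \<in> I \<Longrightarrow> e \<notin> X l" and M: "M \<in> one_factors V E" for e M
  proof (rule ccontr)
    assume "e \<notin> M"
    obtain M0 where M0: "M0 \<in> one_factors V E" "e \<in> M0"
      using in_factor e by blast
    \<comment> \<open>\<open>M\<close> and \<open>M0\<close> disagree about \<open>e\<close>, so a
      path from \<open>T\<close> to one of them must flip it.\<close>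
    obtain T where T: "(T, M) \<in> Z\<^sup>*" "(T, M0) \<in> Z\<^sup>*"
      using common_ancestor[OF M M0(1)] .
    obtain M' N' where "(M', N') \<in> Z" "e \<in> sym_diff M' N'"
      using rtrancl_flip[OF T(1), of e] rtrancl_flip[OF T(2), of e] \<open>e \<notin> M\<close> M0(2) by blast
    moreover from this obtain l where "l \<in> I" "direction l (flipped_face M' N')"
      using arc_has_direction by blast
    ultimately show False
      using e(2) unfolding X_def by blast
  qed
  have X_vertex: "\<exists>v\<in>V. \<exists>e\<in>X l. v \<in> e" if l: "l \<in> I" for l
  proof -
    have "P \<noteq> {}"
      using nontrivial by (auto simp: PiE_eq_empty_iff)
    then obtain m m' where m: "(m, m') \<in> Z" "direction l (flipped_face m m')"
      using nontrivial[OF l] direction_exists[OF _ l] by metis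
    then have "m \<noteq> m'"
      using no_loop by auto
    then obtain e where "e \<in> sym_diff m m'"
      by blast
    then have "e \<in> X l"
      using m unfolding X_def by blast
    moreover have "\<exists>v. v \<in> e \<inter> V"
      using edge_path(3)[of e] XE calculation by blast
    ultimately show ?thesis
      by blast
  qed
  \<comment> \<open>Vertices touched in direction \<open>i\<close>: closed under adjacency, yet
    missing every vertex touched in direction \<open>j\<close>.\<close>
  define U where "U = {v \<in> V. \<exists>e\<in>X i. v \<in> e}"
  have closed: "u \<in> U" if v: "v \<in> U" and e: "e \<in> E" "e \<inter> V = {v, u}" for u v e
  proof -
    obtain e1 where e1: "e1 \<in> X i" "v \<in> e1" "v \<in> V"
      using v unfolding U_def by blast
    have "v \<in> e"
      using e by blast
    have "e \<in> X i"
    proof (rule ccontr)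
      assume ne: "e \<notin> X i"
      \<comment> \<open>In another direction \<open>e\<close> would clash with \<open>e1\<close> at
        \<open>v\<close>. Flipped in no direction, it lies in every 1-factor, also in one containing
        \<open>e1\<close>, and so equals \<open>e1\<close>.\<close>
      have "e \<notin> X l" if "l \<in> I" for l
        using X_disjoint[OF ij(1) that _ e1(1) _ e1(3,2) \<open>v \<in> e\<close>] ne by blast
      moreover obtain M where "M \<in> one_factors V E" "e1 \<in> M"
        using in_factor e1 XE by blast
      ultimately have "e = e1"
        using in_all[OF e(1)] one_factor_unique e1 \<open>v \<in> e\<close> by metis
      then show False
        using ne e1 by simp
    qed
    then show ?thesis
      using e unfolding U_def by blast
  qed
  obtain u where u: "u \<in> U"
    using X_vertex[OF ij(1)] unfolding U_def by blast
  obtain v e where v: "v \<in> V" "e \<in> X j" "v \<in> e"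
    using X_vertex[OF ij(2)] by blast
  have "(u, v) \<in> {(x, y). \<exists>e\<in>E. e \<inter> V = {x, y}}\<^sup>*"
    using elem u v unfolding elementary_def connected_graph_def U_def by blast
  then have "v \<in> U"
    by (induction rule: rtrancl_induct) (use u closed in blast)+
  then show False
    using X_disjoint[OF ij] v unfolding U_def by blast
qed

end

section \<open>Transfer to products of distributive lattices\<close>

theorem theorem3p6:
  fixes V W B :: "complex set" and E :: "complex set set"
  assumes "plane_graph V E"
    and "proper_two_coloring V E W B"
    and "elementary V E"
  shows "\<not> (\<exists>(I :: 'i set) (L :: 'i \<Rightarrow> 'a gorder).
            finite I \<and> 2 \<le> card I \<and>
            (\<forall>i\<in>I. finite_distributive_lattice (L i) \<and> 1 < card (carrier (L i))) \<and>
            order_isomorphic (matching_order V E W B) (product_order I L))"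
proof
  assume "\<exists>(I :: 'i set) (L :: 'i \<Rightarrow> 'a gorder).
            finite I \<and> 2 \<le> card I \<and>
            (\<forall>i\<in>I. finite_distributive_lattice (L i) \<and> 1 < card (carrier (L i))) \<and>
            order_isomorphic (matching_order V E W B) (product_order I L)"
  then obtain I :: "'i set" and L :: "'i \<Rightarrow> 'a gorder" where I: "finite I" "2 \<le> card I"
      and L: "\<And>i. i \<in> I \<Longrightarrow> finite_distributive_lattice (L i)"
        "\<And>i. i \<in> I \<Longrightarrow> 1 < card (carrier (L i))"
      and iso: "order_isomorphic (matching_order V E W B) (product_order I L)"
    by blast
  interpret plane_bipartite V W B E
    using assms by unfold_locales
  let ?S = "one_factors V E" and ?A = "\<lambda>i. carrier (L i)" and ?r = "\<lambda>i. le (L i)"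
  obtain h where h: "bij_betw h ?S (Pi\<^sub>E I ?A)"
      and h_le: "\<And>x y. x \<in> ?S \<Longrightarrow> y \<in> ?S \<Longrightarrow> (y, x) \<in> Z\<^sup>* \<longleftrightarrow> (\<forall>i\<in>I. ?r i (h x i) (h y i))"
    using iso unfolding order_isomorphic_def matching_order_def product_order_def by auto
  \<comment> \<open>The isomorphism \<open>h\<close> sends 1-factors to tuples, whereas
    \<open>flip_product\<close> parametrises 1-factors by tuples.\<close>
  define k where "k = inv_into ?S h"
  have k: "bij_betw k (Pi\<^sub>E I ?A) ?S"
    using h unfolding k_def by (rule bij_betw_inv_into)
  have hk: "h (k u) = u" if "u \<in> Pi\<^sub>E I ?A" for u
    using bij_betw_inv_into_right[OF h that] by (simp add: k_def)
  have lat: "lattice (L i)" if "i \<in> I" for i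
    using L(1)[OF that] unfolding finite_distributive_lattice_def by simp
  have fp: "flip_product Z ?S flipped_face height I ?A ?r k"
  proof
    show "Z \<subseteq> ?S \<times> ?S"
      using Z_factors(1,2) by auto
    show "height n f = height m f + (if f = flipped_face m n then 1 else 0)" if "(m, n) \<in> Z" for m n f
      using height_arc[OF that] .
    show "n = n'" if "(m, n) \<in> Z" "(m, n') \<in> Z" "flipped_face m n = flipped_face m n'" for m n n'
      using flipped_face_inj[OF that] .
    show "(k v, k u) \<in> Z\<^sup>* \<longleftrightarrow> (\<forall>i\<in>I. ?r i (u i) (v i))"
      if "u \<in> Pi\<^sub>E I ?A" "v \<in> Pi\<^sub>E I ?A" for u v
      using h_le[of "k u" "k v"] that hk bij_betw_apply[OF k] by simp
    fix i assume i: "i \<in> I"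
    interpret lattice "L i"
      using lat i .
    show "?r i a a" if "a \<in> ?A i" for a
      using that by simp
    show "a = b" if "a \<in> ?A i" "b \<in> ?A i" "?r i a b" "?r i b a" for a b
      using that le_antisym by blast
    show "?r i a c" if "a \<in> ?A i" "b \<in> ?A i" "c \<in> ?A i" "?r i a b" "?r i b c" for a b c
      using that le_trans by blast
    show "\<exists>c\<in>?A i. ?r i a c \<and> ?r i b c" if "a \<in> ?A i" "b \<in> ?A i" for a b
      using that join_left join_right join_closed by blast
  qed (fact k)
  obtain i j where ij: "i \<in> I" "j \<in> I" "i \<noteq> j"
    using I by (metis card_le_Suc0_iff_eq not_less_eq_eq numeral_2_eq_2)
  have "\<exists>b c. b \<in> ?A i \<and> c \<in> ?A i \<and> b \<noteq> c" if "i \<in> I" for i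
  proof -
    have "finite (?A i)" "\<not> card (?A i) \<le> Suc 0"
      using L[OF that] unfolding finite_distributive_lattice_def by auto
    then show ?thesis
      by (metis card_le_Suc0_iff_eq)
  qed
  then show False
    using not_product[OF assms(3) fp ij] by blast
qed

end
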